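(* Let $I_1,I_2\subseteq\mathbb{R}$ be nonempty open intervals, let $D:=\frac12(I_1+I_2)$, and let $\varphi:D\to\mathbb{R}$ be such that its zero set $\mathscr{Z}_\varphi=\{u\in D\mid \varphi(u)=0\}$ is closed in $D$. Let $f_1:I_1\to\mathbb{R}$ and $f_2:I_2\to\mathbb{R}$ be functions. Then $$\varphi\Big(\frac{x+y}{2}\Big)\big(f_1(x)-f_2(y)\big)=0\qquad\text{for all }(x,y)\in I_1\times I_2$$ if and only if at least one of the following statements holds. (i) The triplet $(\varphi,f_1,f_2)$ is extremal. (ii) There exist constants $\lambda,\mu\in\mathbb{R}$ and (possibly empty) open intervals $U_1,U_2\subseteq I_1$ and $V_1,V_2\subseteq I_2$ such that: - $\inf U_1=\inf I_1$ if $U_1\neq\emptyset$, $\inf V_1=\inf I_2$ if $V_1\neq\emptyset$, $\sup U_2=\sup I_1$ if $U_2\neq\emptyset$, and $\sup V_2=\sup I_2$ if $V_2\neq\emptyset$; - $U_1$ and $V_1$ are both nonempty, or $U_2$ and $V_2$ are both nonempty; - the sets $K_1:=I_1\setminus(U_1\cup U_2)$ and $K_2:=I_2\setminus(V_1\cup V_2)$ are proper subintervals of $I_1$ and $I_2$, closed in $I_1$ and $I_2$, respectively; - $f_1(x)=f_2(y)=\lambda$ for all $(x,y)\in U_1\times V_1$, and $f_1(x)=f_2(y)=\mu$ for all $(x,y)\in U_2\times V_2$ (each condition being void if the corresponding product is empty); - $\varphi(u)=0$ for all $u\in\frac12(K_1+I_2)\cup\frac12(I_1+K_2)$. (iii)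 There exist a constant $\lambda\in\mathbb{R}$, indices $i,j\in\{1,2\}$ with $i\neq j$, and a sequence $(U_n)$ of pairwise disjoint nonempty open subintervals of $I_i$ such that $$f_i(x)=\lambda\ \text{ if } x\in\bigcup_n U_n,\qquad f_j(y)=\lambda\ \text{ if } y\in I_j,\qquad \varphi(u)=0\ \text{ if } u\in\tfrac12(\mathscr{K}_i+I_j),$$ where $\mathscr{K}_i:=I_i\setminus\bigcup_n U_n$.
   Context: For sets $A,B\subseteq\mathbb{R}$, $\frac12(A+B):=\{\frac12(a+b)\mid a\in A,\ b\in B\}$ (empty if $A$ or $B$ is empty). Intervals may be unbounded, and $\inf$, $\sup$ are taken in the extended reals. A triplet $(\varphi,f_1,f_2)$ with $\varphi:D\to\mathbb{R}$, $f_1:I_1\to\mathbb{R}$, $f_2:I_2\to\mathbb{R}$ is called extremal if either $\varphi$ is identically zero on $D$, or there exists $\lambda\in\mathbb{R}$ such that $f_1(x)=f_2(y)=\lambda$ for all $x\in I_1$ and $y\in I_2$. A subset $H$ of an interval $J$ is called proper if $H\notin\{\emptyset,J\}$. A sequence of intervals $(U_n)$ means a nonempty countable (finite or countably infinite) family of intervals. A single point counts as an interval. *)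

theory Defs
  imports "HOL-Analysis.Analysis"
begin

definition midpoints :: "real set \<Rightarrow> real set \<Rightarrow> real set" where
  "midpoints A B = {(a + b) / 2 | a b. a \<in> A \<and> b \<in> B}"

definition open_subinterval :: "real set \<Rightarrow> real set \<Rightarrow> bool" where
  "open_subinterval U J \<longleftrightarrow> open U \<and> is_interval U \<and> U \<subseteq> J"

text \<open>Intervals may be degenerate or unbounded; a proper subinterval may be a single point.\<close>

definition proper_subinterval :: "real set \<Rightarrow> real set \<Rightarrow> bool" where
  "proper_subinterval K J \<longleftrightarrow> is_interval K \<and> K \<subseteq> J \<and> K \<noteq> {} \<and> K \<noteq> J"

text \<open>The functions are total in HOL; only their values on the domains
  \<open>midpoints I1 I2\<close>, \<open>I1\<close> and \<open>I2\<close> matter.\<close>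

definition extremal ::
  "real set \<Rightarrow> real set \<Rightarrow> (real \<Rightarrow> real) \<Rightarrow> (real \<Rightarrow> real) \<Rightarrow> (real \<Rightarrow> real) \<Rightarrow> bool" where
  "extremal I1 I2 \<phi> f1 f2 \<longleftrightarrow>
     (\<forall>u \<in> midpoints I1 I2. \<phi> u = 0) \<or>
     (\<exists>c. \<forall>x \<in> I1. \<forall>y \<in> I2. f1 x = c \<and> f2 y = c)"

end

theory Submission
  imports Defs
begin

text \<open>
  Write \<open>I\<close> and \<open>J\<close> for the two intervals and let \<open>S\<close> be the set of those sums \<open>s\<close> for
  which \<open>\<phi> (s / 2) \<noteq> 0\<close>.  The functional equation says that \<open>f x = g y\<close> whenever
  \<open>x + y \<in> S\<close>, and the hypothesis on the zero set says that \<open>S\<close> is open.  Call \<open>x \<in> I\<close>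
  blocked if no \<open>y \<in> J\<close> gives \<open>x + y \<in> S\<close>; the equation puts no constraint on \<open>f x\<close> exactly
  at such points.  If \<open>x\<close> is not blocked, then one \<open>y\<close> serves a whole neighbourhood of \<open>x\<close>, so
  \<open>f\<close> is locally constant off the blocked set (\<open>constant_on_unblocked\<close>).

  If \<open>I\<close> has no blocked point, then \<open>f\<close> is constant on \<open>I\<close>, hence \<open>g\<close> takes the same value at
  every unblocked point of \<open>J\<close>.  The unblocked points of \<open>J\<close> form an open set, whose
  components are the intervals of the one-sided alternative.  The case that \<open>J\<close> has no blocked point is
  symmetric.

  Suppose that there are blocked points \<open>k \<in> I\<close> and \<open>l \<in> J\<close>.  Consider \<open>(x, y)\<close> with \<open>x < k\<close> and
  \<open>l < y\<close>, and move along the line \<open>x + y = const\<close> towards \<open>(k, l)\<close>.  The first of the two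
  coordinates to arrive becomes blocked while the other is still in its interval, so
  \<open>x + y \<notin> S\<close> (\<open>sum_avoids_opposite_sides\<close>).  This has two consequences.  First, the blocked
  points of either interval again form an interval (\<open>is_interval_blocked\<close>), so the unblocked
  points split into a left and a right part.  Secondly, \<open>S\<close> only connects left with left and right
  with right, so the constant values of \<open>f\<close> and \<open>g\<close> agree on the two left parts and on
  the two right parts, which is the two-sided alternative.  The same geometric fact shows that
  this alternative implies the equation: on the mixed pairs, left with right, \<open>\<phi>\<close> vanishes at the
  midpoint.
\<close>

section \<open>Blocked points\<close>

lemma ball_midpoints:
  "(\<forall>u \<in> midpoints A B. P u) \<longleftrightarrow> (\<forall>x \<in> A. \<forall>y \<in> B. P ((x + y) / 2))"
  unfolding midpoints_def by blast

text \<open>Passing from midpoints to sums removes the factor \<open>1/2\<close> from all later arguments.  The sums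
  are cut down to those that occur because the zero set is only relatively closed.\<close>

definition support_sums :: "real set \<Rightarrow> real set \<Rightarrow> (real \<Rightarrow> real) \<Rightarrow> real set" where
  "support_sums I J \<phi> = {s. s / 2 \<in> midpoints I J \<and> \<phi> (s / 2) \<noteq> 0}"

lemma support_sums_commute: "support_sums J I \<phi> = support_sums I J \<phi>"
proof -
  have "midpoints J I = midpoints I J"
    unfolding midpoints_def by (metis add.commute)
  then show ?thesis
    by (simp add: support_sums_def)
qed

lemma sum_in_support_sums_iff:
  assumes "x \<in> I" "y \<in> J"
  shows "x + y \<in> support_sums I J \<phi> \<longleftrightarrow> \<phi> ((x + y) / 2) \<noteq> 0"
  using assms unfolding support_sums_def midpoints_def by blast

lemma open_midpoints:
  assumes "open I"
  shows "open (midpoints I J)"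
proof -
  have "midpoints I J = (\<Union>y\<in>J. (\<lambda>u. 2 * u - y) -` I)"
  proof (intro equalityI subsetI)
    fix u assume "u \<in> (\<Union>y\<in>J. (\<lambda>u. 2 * u - y) -` I)"
    then obtain y where "y \<in> J" "2 * u - y \<in> I"
      by auto
    moreover have "u = ((2 * u - y) + y) / 2"
      by simp
    ultimately show "u \<in> midpoints I J"
      unfolding midpoints_def by blast
  next
    fix u assume "u \<in> midpoints I J"
    then obtain x y where xy: "x \<in> I" "y \<in> J" "u = (x + y) / 2"
      unfolding midpoints_def by blast
    then have "2 * u - y = x"
      by simp
    with xy(1,2) show "u \<in> (\<Union>y\<in>J. (\<lambda>u. 2 * u - y) -` I)"
      by blast
  qed
  moreover have "open ((\<lambda>u. 2 * u - y) -` I)" for y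
    by (intro open_vimage assms continuous_intros)
  ultimately show ?thesis
    by auto
qed

lemma open_support_sums:
  assumes "open I"
    and "closedin (top_of_set (midpoints I J)) {u \<in> midpoints I J. \<phi> u = 0}"
  shows "open (support_sums I J \<phi>)"
proof -
  let ?D = "midpoints I J"
  have "openin (top_of_set ?D) (?D - {u \<in> ?D. \<phi> u = 0})"
    using assms(2) by (simp add: closedin_def)
  then have "open (?D - {u \<in> ?D. \<phi> u = 0})"
    using open_midpoints[OF assms(1)] openin_open_trans by blast
  then have "open ((\<lambda>s. s / 2) -` (?D - {u \<in> ?D. \<phi> u = 0}))"
    by (rule open_vimage) (intro continuous_intros, simp)
  moreover have "(\<lambda>s. s / 2) -` (?D - {u \<in> ?D. \<phi> u = 0}) = support_sums I J \<phi>"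
    by (auto simp: support_sums_def)
  ultimately show ?thesis
    by simp
qed

definition blocked :: "real set \<Rightarrow> real set \<Rightarrow> real set \<Rightarrow> real set" where
  "blocked S I J = {x \<in> I. \<forall>y \<in> J. x + y \<notin> S}"

lemma blocked_subset: "blocked S I J \<subseteq> I"
  by (auto simp: blocked_def)

lemma open_unblocked:
  assumes "open S" "open I"
  shows "open (I - blocked S I J)"
proof -
  have "I - blocked S I J = I \<inter> (\<Union>y\<in>J. (\<lambda>x. x + y) -` S)"
    by (auto simp: blocked_def)
  moreover have "open ((\<lambda>x. x + y) -` S)" for y
    by (intro open_vimage assms continuous_intros)
  ultimately show ?thesis
    using assms(2) by (metis open_Int open_UN)
qed

text \<open>A single partner \<open>y\<close> of \<open>x\<close> stays a partner of all points near \<open>x\<close>, because \<open>S\<close> is open; hence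
  \<open>f\<close> has the value \<open>g y\<close> near \<open>x\<close>.\<close>

lemma constant_on_unblocked:
  assumes "open S"
    and eq: "\<And>x y. x \<in> I \<Longrightarrow> y \<in> J \<Longrightarrow> x + y \<in> S \<Longrightarrow> f x = g y"
    and "connected C" and C: "C \<subseteq> I - blocked S I J"
  shows "\<exists>c. \<forall>x\<in>C. f x = c"
proof -
  have "eventually (\<lambda>x'. f x = f x') (at x within C)" if x: "x \<in> C" for x
  proof -
    obtain y where y: "y \<in> J" "x + y \<in> S"
      using x C by (auto simp: blocked_def)
    have "open ((\<lambda>x'. x' + y) -` S)"
      by (intro open_vimage assms continuous_intros)
    with y have "eventually (\<lambda>x'. x' \<in> (\<lambda>x'. x' + y) -` S) (at x within C)"
      by (intro eventually_at_topological[THEN iffD2]) blast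
    moreover have "eventually (\<lambda>x'. x' \<in> C) (at x within C)"
      by (auto simp: eventually_at_filter)
    ultimately show ?thesis
    proof eventually_elim
      case (elim x')
      then show ?case
        using eq[of x y] eq[of x' y] x y C by (auto simp: subset_iff)
    qed
  qed
  then have "f a = f b" if "a \<in> C" "b \<in> C" for a b
    using connected_local_const[OF \<open>connected C\<close> that] by blast
  then show ?thesis
    by blast
qed

section \<open>The crossing argument\<close>

text \<open>Slide \<open>(x, y)\<close> along its antidiagonal towards \<open>(k, l)\<close>.  If \<open>x\<close> reaches \<open>k\<close> first, then the sum
  is \<open>k\<close> plus a point between \<open>l\<close> and \<open>y\<close>; otherwise it is \<open>l\<close> plus a point between \<open>x\<close> and \<open>k\<close>.\<close>

lemma sum_avoids_opposite_sides:
  fixes x y k l :: real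
  assumes "is_interval I" "is_interval J"
    and "x \<in> I" "k \<in> I" "y \<in> J" "l \<in> J" "x < k" "l < y"
    and k: "\<And>y. y \<in> J \<Longrightarrow> k + y \<notin> S"
    and l: "\<And>x. x \<in> I \<Longrightarrow> x + l \<notin> S"
  shows "x + y \<notin> S"
proof (cases "k - x \<le> y - l")
  case True
  then have "x + y - k \<in> J"
    using assms by (auto intro: mem_is_interval_1_I[of J l y])
  from k[OF this] show ?thesis
    by simp
next
  case False
  then have "x + y - l \<in> I"
    using assms by (auto intro: mem_is_interval_1_I[of I x k])
  from l[OF this] show ?thesis
    by simp
qed

lemma blocked_avoids_opposite_sides:
  assumes "is_interval I" "is_interval J" "x \<in> I" "y \<in> J"
    and "k \<in> blocked S I J" "l \<in> blocked S J I"
    and "x < k \<and> l < y \<or> k < x \<and> y < l"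
  shows "x + y \<notin> S"
  using assms(7)
proof
  assume "x < k \<and> l < y"
  then show ?thesis
    using assms
    by (intro sum_avoids_opposite_sides[of I J x k y l]) (auto simp: blocked_def add.commute)
next
  assume "k < x \<and> y < l"
  then have "y + x \<notin> S"
    using assms
    by (intro sum_avoids_opposite_sides[of J I y l x k]) (auto simp: blocked_def add.commute)
  then show ?thesis
    by (simp add: add.commute)
qed

text \<open>A point \<open>x\<close> between two blocked points \<open>k\<close> and \<open>k'\<close> lies to the right of one and to the left of
  the other, so for every \<open>y\<close> on either side of the blocked point \<open>l\<close> there is one of them to cross
  with.\<close>

lemma is_interval_blocked:
  assumes I: "is_interval I" and J: "is_interval J" and l: "l \<in> blocked S J I"
  shows "is_interval (blocked S I J)"
  unfolding is_interval_1
proof (intro ballI allI impI)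
  fix k k' x
  assume k: "k \<in> blocked S I J" "k' \<in> blocked S I J" and x: "k \<le> x \<and> x \<le> k'"
  have xI: "x \<in> I"
    using I k x blocked_subset by (meson mem_is_interval_1_I subsetD)
  have "x + y \<notin> S" if y: "y \<in> J" for y
  proof (cases "x = k \<or> x = k' \<or> y = l")
    case True
    then show ?thesis
      using k l y xI by (auto simp: blocked_def add.commute)
  next
    case False
    then show ?thesis
      using blocked_avoids_opposite_sides[OF I J xI y k(1) l]
        blocked_avoids_opposite_sides[OF I J xI y k(2) l] x by linarith
  qed
  with xI show "x \<in> blocked S I J"
    by (simp add: blocked_def)
qed

section \<open>Parts of an interval on either side of a subinterval\<close>

definition left_part :: "real set \<Rightarrow> real set \<Rightarrow> real set" where
  "left_part I K = {x \<in> I. \<forall>k \<in> K. x < k}"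

definition right_part :: "real set \<Rightarrow> real set \<Rightarrow> real set" where
  "right_part I K = {x \<in> I. \<forall>k \<in> K. k < x}"

lemma complement_left_right_part:
  assumes "is_interval K" "K \<subseteq> I" "K \<noteq> {}"
  shows "I - (left_part I K \<union> right_part I K) = K"
proof (intro equalityI subsetI)
  fix x assume "x \<in> I - (left_part I K \<union> right_part I K)"
  then obtain k k' where "k \<in> K" "k \<le> x" "k' \<in> K" "x \<le> k'"
    unfolding left_part_def right_part_def by (auto simp: not_less)
  then show "x \<in> K"
    using assms(1) by (meson mem_is_interval_1_I)
qed (use assms in \<open>auto simp: left_part_def right_part_def\<close>)

text \<open>A neighbourhood of \<open>x\<close> that misses \<open>K\<close> cannot reach beyond a point of \<open>K\<close>.\<close>

lemma open_subinterval_left_right_part: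
  assumes I: "is_interval I" and K: "open (I - K)" "K \<noteq> {}"
  shows "open_subinterval (left_part I K) I" "open_subinterval (right_part I K) I"
proof -
  have near: "\<exists>e>0. \<forall>x'. dist x' x < e \<longrightarrow> x' \<in> I - K" if "x \<in> I - K" for x
    using K(1) that unfolding open_dist by blast
  have "open (left_part I K)"
    unfolding open_dist
  proof
    fix x assume x: "x \<in> left_part I K"
    then have "x \<in> I - K"
      by (auto simp: left_part_def)
    then obtain e where e: "e > 0" "\<And>x'. dist x' x < e \<Longrightarrow> x' \<in> I - K"
      using near by blast
    have "x' \<in> left_part I K" if x': "dist x' x < e" for x'
    proof -
      have "x' < k" if k: "k \<in> K" for k
      proof (rule ccontr)
        assume "\<not> x' < k"
        moreover have "x < k"
          using x k by (auto simp: left_part_def)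
        ultimately have "dist k x < e"
          using x' by (auto simp: dist_real_def)
        then show False
          using e(2) k by blast
      qed
      then show ?thesis
        using e(2)[OF x'] by (auto simp: left_part_def)
    qed
    with e(1) show "\<exists>e>0. \<forall>x'. dist x' x < e \<longrightarrow> x' \<in> left_part I K"
      by blast
  qed
  moreover have "is_interval (left_part I K)"
    using I unfolding left_part_def is_interval_1 by (smt (verit) mem_Collect_eq)
  ultimately show "open_subinterval (left_part I K) I"
    by (auto simp: open_subinterval_def left_part_def)
  have "open (right_part I K)"
    unfolding open_dist
  proof
    fix x assume x: "x \<in> right_part I K"
    then have "x \<in> I - K"
      by (auto simp: right_part_def)
    then obtain e where e: "e > 0" "\<And>x'. dist x' x < e \<Longrightarrow> x' \<in> I - K"
      using near by blast
    have "x' \<in> right_part I K" if x': "dist x' x < e" for x'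
    proof -
      have "k < x'" if k: "k \<in> K" for k
      proof (rule ccontr)
        assume "\<not> k < x'"
        moreover have "k < x"
          using x k by (auto simp: right_part_def)
        ultimately have "dist k x < e"
          using x' by (auto simp: dist_real_def)
        then show False
          using e(2) k by blast
      qed
      then show ?thesis
        using e(2)[OF x'] by (auto simp: right_part_def)
    qed
    with e(1) show "\<exists>e>0. \<forall>x'. dist x' x < e \<longrightarrow> x' \<in> right_part I K"
      by blast
  qed
  moreover have "is_interval (right_part I K)"
    using I unfolding right_part_def is_interval_1 by (smt (verit) mem_Collect_eq)
  ultimately show "open_subinterval (right_part I K) I"
    by (auto simp: open_subinterval_def right_part_def)
qed

lemma Inf_left_part:
  assumes "left_part I K \<noteq> {}"
  shows "Inf (ereal ` left_part I K) = Inf (ereal ` I)"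
proof -
  obtain u where u: "u \<in> left_part I K"
    using assms by blast
  have "\<exists>v \<in> left_part I K. v \<le> x" if "x \<in> I" for x
  proof (cases "x \<in> left_part I K")
    case False
    then have "u \<le> x"
      using that u unfolding left_part_def by force
    then show ?thesis
      using u by blast
  qed auto
  then show ?thesis
    by (intro INF_eq) (auto simp: left_part_def)
qed

lemma Sup_right_part:
  assumes "right_part I K \<noteq> {}"
  shows "Sup (ereal ` right_part I K) = Sup (ereal ` I)"
proof -
  obtain u where u: "u \<in> right_part I K"
    using assms by blast
  have "\<exists>v \<in> right_part I K. x \<le> v" if "x \<in> I" for x
  proof (cases "x \<in> right_part I K")
    case False
    then have "x \<le> u"
      using that u unfolding right_part_def by force
    then show ?thesis
      using u by blast
  qed auto
  then show ?thesis
    by (intro SUP_eq) (auto simp: right_part_def)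
qed

text \<open>Conversely, a subinterval that shares the infimum of \<open>I\<close> is an initial segment of \<open>I\<close>.
  Openness of \<open>I\<close> matters: a minimum \<open>k\<close> of \<open>I\<close> could otherwise be missing from \<open>U\<close>.\<close>

lemma less_of_same_Inf:
  assumes "open I" "open_subinterval U I" "Inf (ereal ` U) = Inf (ereal ` I)"
    and "x \<in> U" "k \<in> I" "k \<notin> U"
  shows "x < k"
proof (rule ccontr)
  assume "\<not> x < k"
  obtain e where "e > 0" "\<And>z. dist z k < e \<Longrightarrow> z \<in> I"
    using assms(1,5) unfolding open_dist by blast
  then have "k - e / 2 \<in> I"
    by (simp add: dist_real_def)
  then have "Inf (ereal ` I) \<le> ereal (k - e / 2)"
    by (intro Inf_lower) auto
  also have "\<dots> < ereal k"
    using \<open>e > 0\<close> by simp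
  finally have "Inf (ereal ` U) < ereal k"
    using assms(3) by simp
  then obtain u where "u \<in> U" "u < k"
    by (auto simp: Inf_less_iff)
  then have "k \<in> U"
    using assms(2,4) \<open>\<not> x < k\<close> unfolding open_subinterval_def
    by (meson mem_is_interval_1_I not_less less_imp_le)
  with assms(6) show False ..
qed

lemma greater_of_same_Sup:
  assumes "open I" "open_subinterval U I" "Sup (ereal ` U) = Sup (ereal ` I)"
    and "x \<in> U" "k \<in> I" "k \<notin> U"
  shows "k < x"
proof (rule ccontr)
  assume "\<not> k < x"
  obtain e where "e > 0" "\<And>z. dist z k < e \<Longrightarrow> z \<in> I"
    using assms(1,5) unfolding open_dist by blast
  then have "k + e / 2 \<in> I"
    by (simp add: dist_real_def)
  have "ereal k < ereal (k + e / 2)"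
    using \<open>e > 0\<close> by simp
  also have "\<dots> \<le> Sup (ereal ` I)"
    using \<open>k + e / 2 \<in> I\<close> by (intro Sup_upper) auto
  finally have "ereal k < Sup (ereal ` U)"
    using assms(3) by simp
  then obtain u where "u \<in> U" "k < u"
    by (auto simp: less_Sup_iff)
  then have "k \<in> U"
    using assms(2,4) \<open>\<not> k < x\<close> unfolding open_subinterval_def
    by (meson mem_is_interval_1_I not_less less_imp_le)
  with assms(6) show False ..
qed

lemma open_eq_disjoint_UN_intervals:
  fixes B :: "real set"
  assumes "open B"
  obtains N :: "nat set" and U :: "nat \<Rightarrow> real set"
  where "disjoint_family_on U N" "\<And>n. n \<in> N \<Longrightarrow> U n \<noteq> {} \<and> open_subinterval (U n) B"
    "(\<Union>n\<in>N. U n) = B"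
proof -
  let ?C = "components B"
  have "countable ?C"
    using assms by (intro countable_disjoint_open_subsets)
      (auto simp: open_components disjoint_def dest: components_nonoverlap)
  let ?N = "to_nat_on ?C ` ?C" and ?U = "from_nat_into ?C"
  have U: "?U (to_nat_on ?C c) = c" if "c \<in> ?C" for c
    using \<open>countable ?C\<close> that by simp
  show thesis
  proof
    show "disjoint_family_on ?U ?N"
      unfolding disjoint_family_on_def using U components_nonoverlap[of _ B] by force
    show "?U n \<noteq> {} \<and> open_subinterval (?U n) B" if n: "n \<in> ?N" for n
    proof -
      have c: "?U n \<in> ?C"
        using n U by auto
      then show ?thesis
        unfolding open_subinterval_def is_interval_connected_1
        using in_components_nonempty[OF c] open_components[OF assms c]
          in_components_connected[OF c] in_components_subset[OF c] by blast
    qed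
    show "(\<Union>n\<in>?N. ?U n) = B"
      using U Union_components[of B] by auto
  qed
qed

section \<open>The two non-extremal alternatives\<close>

definition two_sided_with ::
  "real \<Rightarrow> real \<Rightarrow> real set \<Rightarrow> real set \<Rightarrow> real set \<Rightarrow> real set \<Rightarrow> real set \<Rightarrow> real set \<Rightarrow>
    (real \<Rightarrow> real) \<Rightarrow> (real \<Rightarrow> real) \<Rightarrow> (real \<Rightarrow> real) \<Rightarrow> bool" where
  "two_sided_with lam mu U1 U2 V1 V2 I J \<phi> f g \<longleftrightarrow>
    open_subinterval U1 I \<and> open_subinterval U2 I \<and>
    open_subinterval V1 J \<and> open_subinterval V2 J \<and>
    (U1 \<noteq> {} \<longrightarrow> Inf (ereal ` U1) = Inf (ereal ` I)) \<and>
    (V1 \<noteq> {} \<longrightarrow> Inf (ereal ` V1) = Inf (ereal ` J)) \<and>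
    (U2 \<noteq> {} \<longrightarrow> Sup (ereal ` U2) = Sup (ereal ` I)) \<and>
    (V2 \<noteq> {} \<longrightarrow> Sup (ereal ` V2) = Sup (ereal ` J)) \<and>
    (U1 \<noteq> {} \<and> V1 \<noteq> {} \<or> U2 \<noteq> {} \<and> V2 \<noteq> {}) \<and>
    (let K1 = I - (U1 \<union> U2); K2 = J - (V1 \<union> V2) in
       proper_subinterval K1 I \<and> closedin (top_of_set I) K1 \<and>
       proper_subinterval K2 J \<and> closedin (top_of_set J) K2 \<and>
       (\<forall>(x, y) \<in> U1 \<times> V1. f x = lam \<and> g y = lam) \<and>
       (\<forall>(x, y) \<in> U2 \<times> V2. f x = mu \<and> g y = mu) \<and>
       (\<forall>u \<in> midpoints K1 J \<union> midpoints I K2. \<phi> u = 0))"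

definition two_sided ::
  "real set \<Rightarrow> real set \<Rightarrow> (real \<Rightarrow> real) \<Rightarrow> (real \<Rightarrow> real) \<Rightarrow> (real \<Rightarrow> real) \<Rightarrow> bool" where
  "two_sided I J \<phi> f g \<longleftrightarrow>
    (\<exists>lam mu U1 U2 V1 V2. two_sided_with lam mu U1 U2 V1 V2 I J \<phi> f g)"

definition one_sided ::
  "real set \<Rightarrow> real set \<Rightarrow> (real \<Rightarrow> real) \<Rightarrow> (real \<Rightarrow> real) \<Rightarrow> (real \<Rightarrow> real) \<Rightarrow> bool" where
  "one_sided I J \<phi> f g \<longleftrightarrow>
    (\<exists>lam :: real. \<exists>(N :: nat set) (U :: nat \<Rightarrow> real set).
       N \<noteq> {} \<and> disjoint_family_on U N \<and>
       (\<forall>n \<in> N. U n \<noteq> {} \<and> open_subinterval (U n) I) \<and>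
       (\<forall>x \<in> (\<Union>n \<in> N. U n). f x = lam) \<and>
       (\<forall>y \<in> J. g y = lam) \<and>
       (\<forall>u \<in> midpoints (I - (\<Union>n \<in> N. U n)) J. \<phi> u = 0))"

lemma extremal_imp_equation:
  assumes "extremal I J \<phi> f g" "x \<in> I" "y \<in> J"
  shows "\<phi> ((x + y) / 2) * (f x - g y) = 0"
  using assms unfolding extremal_def ball_midpoints by fastforce

lemma one_sided_imp_equation:
  assumes "one_sided I J \<phi> f g" "x \<in> I" "y \<in> J"
  shows "\<phi> ((x + y) / 2) * (f x - g y) = 0"
  using assms unfolding one_sided_def ball_midpoints
  by (metis DiffI cancel_comm_monoid_add_class.diff_cancel mult_eq_0_iff)

text \<open>Only pairs from a left and a right part need an argument; for them any points of the two
  removed intervals serve as the blocked points of the crossing argument.\<close>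

lemma two_sided_imp_equation:
  assumes "open I" "is_interval I" "open J" "is_interval J"
    and "two_sided I J \<phi> f g" and x: "x \<in> I" and y: "y \<in> J"
  shows "\<phi> ((x + y) / 2) * (f x - g y) = 0"
proof -
  obtain lam mu U1 U2 V1 V2 where "two_sided_with lam mu U1 U2 V1 V2 I J \<phi> f g"
    using assms(5) unfolding two_sided_def by blast
  note data = this[unfolded two_sided_with_def Let_def ball_Un ball_midpoints]
  have sub: "open_subinterval U1 I" "open_subinterval U2 I"
      "open_subinterval V1 J" "open_subinterval V2 J" and
    ends: "U1 \<noteq> {} \<Longrightarrow> Inf (ereal ` U1) = Inf (ereal ` I)"
      "V1 \<noteq> {} \<Longrightarrow> Inf (ereal ` V1) = Inf (ereal ` J)"
      "U2 \<noteq> {} \<Longrightarrow> Sup (ereal ` U2) = Sup (ereal ` I)"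
      "V2 \<noteq> {} \<Longrightarrow> Sup (ereal ` V2) = Sup (ereal ` J)" and
    proper: "proper_subinterval (I - (U1 \<union> U2)) I" "proper_subinterval (J - (V1 \<union> V2)) J"
    using data by simp_all
  have "\<forall>(x, y) \<in> U1 \<times> V1. f x = lam \<and> g y = lam"
      "\<forall>(x, y) \<in> U2 \<times> V2. f x = mu \<and> g y = mu"
    by - (insert data, elim conjE, assumption)+
  then have vals: "\<And>x y. x \<in> U1 \<Longrightarrow> y \<in> V1 \<Longrightarrow> f x = lam \<and> g y = lam"
      "\<And>x y. x \<in> U2 \<Longrightarrow> y \<in> V2 \<Longrightarrow> f x = mu \<and> g y = mu"
    by simp_all
  have "\<forall>x \<in> I - (U1 \<union> U2). \<forall>y \<in> J. \<phi> ((x + y) / 2) = 0"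
      "\<forall>x \<in> I. \<forall>y \<in> J - (V1 \<union> V2). \<phi> ((x + y) / 2) = 0"
    by - (insert data, elim conjE, assumption)+
  then have zero: "\<And>x y. x \<in> I - (U1 \<union> U2) \<Longrightarrow> y \<in> J \<Longrightarrow> \<phi> ((x + y) / 2) = 0"
      "\<And>x y. x \<in> I \<Longrightarrow> y \<in> J - (V1 \<union> V2) \<Longrightarrow> \<phi> ((x + y) / 2) = 0"
    by simp_all
  let ?S = "support_sums I J \<phi>"
  obtain k l where k: "k \<in> I" "k \<notin> U1" "k \<notin> U2" and l: "l \<in> J" "l \<notin> V1" "l \<notin> V2"
    using proper unfolding proper_subinterval_def by blast
  have kl: "k \<in> blocked ?S I J" "l \<in> blocked ?S J I"
    using k l zero by (auto simp: blocked_def sum_in_support_sums_iff add.commute[of l])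
  consider "x \<in> I - (U1 \<union> U2) \<or> y \<in> J - (V1 \<union> V2)" | "x \<in> U1" "y \<in> V1" | "x \<in> U2" "y \<in> V2"
    | "x \<in> U1" "y \<in> V2" | "x \<in> U2" "y \<in> V1"
    using x y by blast
  then show ?thesis
  proof cases
    case 1
    then show ?thesis
      using zero x y by auto
  next
    case 2
    then show ?thesis
      using vals(1) by force
  next
    case 3
    then show ?thesis
      using vals(2) by force
  next
    case 4
    have "x < k"
      using 4 ends(1) k sub(1) less_of_same_Inf[OF \<open>open I\<close>] by blast
    moreover have "l < y"
      using 4 ends(4) l sub(4) greater_of_same_Sup[OF \<open>open J\<close>] by blast
    ultimately have "x + y \<notin> ?S"
      using blocked_avoids_opposite_sides[OF assms(2,4) x y kl] by blast
    then show ?thesis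
      using x y by (simp add: sum_in_support_sums_iff)
  next
    case 5
    have "k < x"
      using 5 ends(3) k sub(2) greater_of_same_Sup[OF \<open>open I\<close>] by blast
    moreover have "y < l"
      using 5 ends(2) l sub(3) less_of_same_Inf[OF \<open>open J\<close>] by blast
    ultimately have "x + y \<notin> ?S"
      using blocked_avoids_opposite_sides[OF assms(2,4) x y kl] by blast
    then show ?thesis
      using x y by (simp add: sum_in_support_sums_iff)
  qed
qed

text \<open>Without blocked points in \<open>J\<close> the whole of \<open>g\<close> is constant, and every unblocked point of \<open>I\<close> has
  a partner in \<open>J\<close> from which \<open>f\<close> inherits that constant.\<close>

lemma one_sided_if_no_blocked:
  assumes "open I" "is_interval J" and S: "open (support_sums I J \<phi>)"
    and eq: "\<And>x y. x \<in> I \<Longrightarrow> y \<in> J \<Longrightarrow> \<phi> ((x + y) / 2) \<noteq> 0 \<Longrightarrow> f x = g y"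
    and none: "blocked (support_sums I J \<phi>) J I = {}"
    and nz: "x0 \<in> I" "y0 \<in> J" "\<phi> ((x0 + y0) / 2) \<noteq> 0"
  shows "one_sided I J \<phi> f g"
proof -
  let ?S = "support_sums I J \<phi>"
  let ?B = "I - blocked ?S I J"
  have "g y = f x" if "y \<in> J" "x \<in> I" "y + x \<in> ?S" for x y
    using eq[of x y] that by (simp add: add.commute[of y] sum_in_support_sums_iff)
  then have "\<exists>c. \<forall>y\<in>J. g y = c"
    by (rule constant_on_unblocked[where f = g and g = f, OF S])
      (use none assms(2) in \<open>auto simp: is_interval_connected_1\<close>)
  then obtain lam where lam: "\<And>y. y \<in> J \<Longrightarrow> g y = lam"
    by blast
  have f: "f x = lam" if "x \<in> ?B" for x
    using that eq lam by (auto simp: blocked_def sum_in_support_sums_iff)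
  obtain N :: "nat set" and U where NU: "disjoint_family_on U N"
    "\<And>n. n \<in> N \<Longrightarrow> U n \<noteq> {} \<and> open_subinterval (U n) ?B" "(\<Union>n\<in>N. U n) = ?B"
    using open_eq_disjoint_UN_intervals[OF open_unblocked[OF S \<open>open I\<close>]] by metis
  have "x0 \<in> ?B"
    using nz by (auto simp: blocked_def sum_in_support_sums_iff)
  then have "N \<noteq> {}"
    using NU(3) by auto
  moreover have "\<forall>n\<in>N. U n \<noteq> {} \<and> open_subinterval (U n) I"
    using NU(2) unfolding open_subinterval_def by blast
  moreover have "\<phi> ((x + y) / 2) = 0" if "x \<in> I - ?B" "y \<in> J" for x y
    using that by (auto simp: blocked_def sum_in_support_sums_iff)
  moreover have "\<forall>x\<in>(\<Union>n\<in>N. U n). f x = lam" "\<forall>y\<in>J. g y = lam"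
    using f lam NU(3) by blast+
  ultimately show ?thesis
    unfolding one_sided_def ball_midpoints using NU(1,3) by metis
qed

text \<open>The four open intervals are the parts on either side of the blocked sets.  By the
  crossing argument a point of a left part has its partners in the other left part, and likewise on the
  right.  This gives the common constants, and a point of the support of \<open>\<phi>\<close> gives a pair of
  nonempty parts on the same side.\<close>

lemma two_sided_if_blocked:
  assumes I: "open I" "is_interval I" and J: "open J" "is_interval J"
    and S: "open (support_sums I J \<phi>)"
    and eq: "\<And>x y. x \<in> I \<Longrightarrow> y \<in> J \<Longrightarrow> \<phi> ((x + y) / 2) \<noteq> 0 \<Longrightarrow> f x = g y"
    and k: "k \<in> blocked (support_sums I J \<phi>) I J"
    and l: "l \<in> blocked (support_sums I J \<phi>) J I"
    and nz: "x0 \<in> I" "y0 \<in> J" "\<phi> ((x0 + y0) / 2) \<noteq> 0"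
  shows "two_sided I J \<phi> f g"
proof -
  define S where "S = support_sums I J \<phi>"
  define K where "K = blocked S I J"
  define L where "L = blocked S J I"
  have S_iff: "x + y \<in> S \<longleftrightarrow> \<phi> ((x + y) / 2) \<noteq> 0" if "x \<in> I" "y \<in> J" for x y
    using that by (simp add: S_def sum_in_support_sums_iff)
  have eqS: "f x = g y" if "x \<in> I" "y \<in> J" "x + y \<in> S" for x y
    using that eq S_iff by blast
  have eqS': "g y = f x" if "y \<in> J" "x \<in> I" "y + x \<in> S" for x y
    using that eqS[of x y] by (simp add: add.commute)
  have oS: "open S"
    using S by (simp add: S_def)
  have kK: "k \<in> K" and lL: "l \<in> L"
    using k l by (simp_all add: K_def L_def S_def)
  have K: "is_interval K" "K \<subseteq> I" "K \<noteq> {}" "open (I - K)"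
    using is_interval_blocked[OF I(2) J(2)] lL kK open_unblocked[OF oS I(1)] blocked_subset
    unfolding K_def L_def by blast+
  have L: "is_interval L" "L \<subseteq> J" "L \<noteq> {}" "open (J - L)"
    using is_interval_blocked[OF J(2) I(2)] lL kK open_unblocked[OF oS J(1)] blocked_subset
    unfolding K_def L_def by blast+
  let ?U1 = "left_part I K" and ?U2 = "right_part I K"
  let ?V1 = "left_part J L" and ?V2 = "right_part J L"
  note splitI = complement_left_right_part[OF K(1-3)]
  note splitJ = complement_left_right_part[OF L(1-3)]
  note subI = open_subinterval_left_right_part[OF I(2) K(4,3)]
  note subJ = open_subinterval_left_right_part[OF J(2) L(4,3)]
  have const: "\<exists>c. \<forall>x\<in>C. f x = c" if "open_subinterval C I" "C \<inter> K = {}" for C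
    by (rule constant_on_unblocked[where f = f and g = g, OF oS eqS])
      (use that in \<open>auto simp: open_subinterval_def is_interval_connected_1 K_def\<close>)
  have const': "\<exists>c. \<forall>y\<in>C. g y = c" if "open_subinterval C J" "C \<inter> L = {}" for C
    by (rule constant_on_unblocked[where f = g and g = f, OF oS eqS'])
      (use that in \<open>auto simp: open_subinterval_def is_interval_connected_1 L_def\<close>)
  have off: "?U1 \<inter> K = {}" "?U2 \<inter> K = {}" "?V1 \<inter> L = {}" "?V2 \<inter> L = {}"
    unfolding left_part_def right_part_def by blast+
  obtain a1 a2 b1 b2 where
    f: "\<And>x. x \<in> ?U1 \<Longrightarrow> f x = a1" "\<And>x. x \<in> ?U2 \<Longrightarrow> f x = a2" and
    g: "\<And>y. y \<in> ?V1 \<Longrightarrow> g y = b1" "\<And>y. y \<in> ?V2 \<Longrightarrow> g y = b2"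
    using const[OF subI(1) off(1)] const[OF subI(2) off(2)]
      const'[OF subJ(1) off(3)] const'[OF subJ(2) off(4)] by blast
  have same_side: "x \<in> ?U1 \<and> y \<in> ?V1 \<or> x \<in> ?U2 \<and> y \<in> ?V2"
    if xy: "x \<in> I" "y \<in> J" "x + y \<in> S" for x y
  proof -
    have "x \<notin> K" "y \<notin> L"
      using xy by (auto simp: K_def L_def blocked_def add.commute)
    then have "x \<in> ?U1 \<union> ?U2" "y \<in> ?V1 \<union> ?V2"
      using splitI splitJ xy by blast+
    moreover have "\<not> (x < k \<and> l < y \<or> k < x \<and> y < l)"
      using blocked_avoids_opposite_sides[OF I(2) J(2) xy(1,2)] kK lL xy(3)
      unfolding K_def L_def by blast
    ultimately show ?thesis
      using kK lL unfolding left_part_def right_part_def by blast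
  qed
  have partner: "\<exists>y\<in>J. x + y \<in> S" if "x \<in> I" "x \<notin> K" for x
    using that by (auto simp: K_def blocked_def)
  have left: "a1 = b1" if "x \<in> ?U1" for x
  proof -
    have x: "x \<in> I" "x \<notin> K" "x \<notin> ?U2"
      using that kK unfolding left_part_def right_part_def by fastforce+
    then obtain y where "y \<in> J" "x + y \<in> S"
      using partner by blast
    then show ?thesis
      using same_side[of x y] eqS[of x y] f(1)[OF that] g(1) x by auto
  qed
  have right: "a2 = b2" if "x \<in> ?U2" for x
  proof -
    have x: "x \<in> I" "x \<notin> K" "x \<notin> ?U1"
      using that kK unfolding left_part_def right_part_def by fastforce+
    then obtain y where "y \<in> J" "x + y \<in> S"
      using partner by blast
    then show ?thesis
      using same_side[of x y] eqS[of x y] f(2)[OF that] g(2) x by auto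
  qed
  have nzS: "x0 + y0 \<in> S"
    using nz S_iff by blast
  have nonempty: "?U1 \<noteq> {} \<and> ?V1 \<noteq> {} \<or> ?U2 \<noteq> {} \<and> ?V2 \<noteq> {}"
    using same_side[OF nz(1,2) nzS] by blast
  have "x0 \<notin> K" "y0 \<notin> L"
    using nz nzS by (auto simp: K_def L_def blocked_def add.commute)
  then have proper: "proper_subinterval K I" "proper_subinterval L J"
    using K L nz unfolding proper_subinterval_def by blast+
  have closed: "closedin (top_of_set I) K" "closedin (top_of_set J) L"
    using K L I J by (simp_all add: closedin_def openin_open_eq)
  have vals: "\<forall>(x, y) \<in> ?U1 \<times> ?V1. f x = a1 \<and> g y = a1"
      "\<forall>(x, y) \<in> ?U2 \<times> ?V2. f x = a2 \<and> g y = a2"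
    using f g left right by auto
  have "\<phi> ((x + y) / 2) = 0" if "x \<in> K \<and> y \<in> J \<or> x \<in> I \<and> y \<in> L" for x y
  proof -
    have "x \<in> I" "y \<in> J"
      using that K(2) L(2) by blast+
    moreover have "x + y \<notin> S"
      using that by (auto simp: K_def L_def blocked_def add.commute)
    ultimately show ?thesis
      using S_iff by blast
  qed
  then have zero: "\<forall>u \<in> midpoints K J \<union> midpoints I L. \<phi> u = 0"
    unfolding ball_Un ball_midpoints by blast
  have "two_sided_with a1 a2 ?U1 ?U2 ?V1 ?V2 I J \<phi> f g"
    unfolding two_sided_with_def Let_def splitI splitJ
    by (intro conjI impI Inf_left_part Sup_right_part subI subJ nonempty proper closed vals zero)
  then show ?thesis
    unfolding two_sided_def by blast
qed

section \<open>The characterization\<close>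

lemma functional_equation_iff:
  assumes "open I" "is_interval I" "open J" "is_interval J"
    and "closedin (top_of_set (midpoints I J)) {u \<in> midpoints I J. \<phi> u = 0}"
  shows "(\<forall>x \<in> I. \<forall>y \<in> J. \<phi> ((x + y) / 2) * (f x - g y) = 0) \<longleftrightarrow>
    extremal I J \<phi> f g \<or> two_sided I J \<phi> f g \<or> one_sided I J \<phi> f g \<or> one_sided J I \<phi> g f"
    (is "?eq \<longleftrightarrow> ?alternatives")
proof
  assume ?eq
  have eq: "f x = g y" if "x \<in> I" "y \<in> J" "\<phi> ((x + y) / 2) \<noteq> 0" for x y
  proof -
    have "\<phi> ((x + y) / 2) * (f x - g y) = 0"
      using \<open>?eq\<close> that(1,2) by blast
    then show ?thesis
      using that(3) by simp
  qed
  have eq': "g y = f x" if "y \<in> J" "x \<in> I" "\<phi> ((y + x) / 2) \<noteq> 0" for x y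
    using that eq[of x y] by (simp add: add.commute)
  let ?S = "support_sums I J \<phi>"
  have S: "open ?S"
    using open_support_sums[OF assms(1,5)] .
  show ?alternatives
  proof (cases "\<forall>u \<in> midpoints I J. \<phi> u = 0")
    case True
    then show ?thesis
      by (simp add: extremal_def)
  next
    case False
    then obtain x0 y0 where nz: "x0 \<in> I" "y0 \<in> J" "\<phi> ((x0 + y0) / 2) \<noteq> 0"
      unfolding ball_midpoints by blast
    consider "blocked ?S J I = {}" | "blocked ?S I J = {}"
      | k l where "k \<in> blocked ?S I J" "l \<in> blocked ?S J I"
      by blast
    then show ?thesis
    proof cases
      case 1
      have "one_sided I J \<phi> f g"
        by (rule one_sided_if_no_blocked[OF assms(1,4) S eq 1 nz])
      then show ?thesis
        by blast
    next
      case 2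
      have "one_sided J I \<phi> g f"
        by (rule one_sided_if_no_blocked[where f = g and g = f, OF assms(3,2) _ eq' _ nz(2,1)])
          (use S 2 nz(3) in \<open>simp_all add: support_sums_commute[of J I] add.commute[of y0]\<close>)
      then show ?thesis
        by blast
    next
      case 3
      have "two_sided I J \<phi> f g"
        by (rule two_sided_if_blocked[OF assms(1-4) S eq 3 nz])
      then show ?thesis
        by blast
    qed
  qed
next
  assume ?alternatives
  have "\<phi> ((x + y) / 2) * (f x - g y) = 0" if xy: "x \<in> I" "y \<in> J" for x y
    using \<open>?alternatives\<close>
  proof (elim disjE)
    assume "one_sided J I \<phi> g f"
    then have "\<phi> ((y + x) / 2) * (g y - f x) = 0"
      using one_sided_imp_equation xy by blast
    then show ?thesis
      by (auto simp: add.commute)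
  next
    assume "extremal I J \<phi> f g"
    then show ?thesis
      by (rule extremal_imp_equation[OF _ xy])
  next
    assume "two_sided I J \<phi> f g"
    then show ?thesis
      by (rule two_sided_imp_equation[OF assms(1-4) _ xy])
  next
    assume "one_sided I J \<phi> f g"
    then show ?thesis
      by (rule one_sided_imp_equation[OF _ xy])
  qed
  then show ?eq
    by blast
qed

theorem theorem6:
  fixes I :: "nat \<Rightarrow> real set" and \<phi> :: "real \<Rightarrow> real" and f :: "nat \<Rightarrow> real \<Rightarrow> real"
  assumes "open (I 1)" and "is_interval (I 1)" and "I 1 \<noteq> {}"
    and "open (I 2)" and "is_interval (I 2)" and "I 2 \<noteq> {}"
    and "closedin (top_of_set (midpoints (I 1) (I 2))) {u \<in> midpoints (I 1) (I 2). \<phi> u = 0}"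
  shows "(\<forall>x \<in> I 1. \<forall>y \<in> I 2. \<phi> ((x + y) / 2) * (f 1 x - f 2 y) = 0) \<longleftrightarrow>
    extremal (I 1) (I 2) \<phi> (f 1) (f 2)
    \<or>
    (\<exists>lam mu :: real. \<exists>U1 U2 V1 V2 :: real set.
       open_subinterval U1 (I 1) \<and> open_subinterval U2 (I 1) \<and>
       open_subinterval V1 (I 2) \<and> open_subinterval V2 (I 2) \<and>
       (U1 \<noteq> {} \<longrightarrow> Inf (ereal ` U1) = Inf (ereal ` I 1)) \<and>
       (V1 \<noteq> {} \<longrightarrow> Inf (ereal ` V1) = Inf (ereal ` I 2)) \<and>
       (U2 \<noteq> {} \<longrightarrow> Sup (ereal ` U2) = Sup (ereal ` I 1)) \<and>
       (V2 \<noteq> {} \<longrightarrow> Sup (ereal ` V2) = Sup (ereal ` I 2)) \<and>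
       (U1 \<noteq> {} \<and> V1 \<noteq> {} \<or> U2 \<noteq> {} \<and> V2 \<noteq> {}) \<and>
       (let K1 = I 1 - (U1 \<union> U2); K2 = I 2 - (V1 \<union> V2) in
          proper_subinterval K1 (I 1) \<and> closedin (top_of_set (I 1)) K1 \<and>
          proper_subinterval K2 (I 2) \<and> closedin (top_of_set (I 2)) K2 \<and>
          (\<forall>(x, y) \<in> U1 \<times> V1. f 1 x = lam \<and> f 2 y = lam) \<and>
          (\<forall>(x, y) \<in> U2 \<times> V2. f 1 x = mu \<and> f 2 y = mu) \<and>
          (\<forall>u \<in> midpoints K1 (I 2) \<union> midpoints (I 1) K2. \<phi> u = 0)))
    \<or>
    (\<exists>lam :: real. \<exists>i \<in> {1, 2}. \<exists>j \<in> {1, 2}. i \<noteq> j \<and>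
       (\<exists>(N :: nat set) (U :: nat \<Rightarrow> real set).
          N \<noteq> {} \<and> disjoint_family_on U N \<and>
          (\<forall>n \<in> N. U n \<noteq> {} \<and> open_subinterval (U n) (I i)) \<and>
          (\<forall>x \<in> (\<Union>n \<in> N. U n). f i x = lam) \<and>
          (\<forall>y \<in> I j. f j y = lam) \<and>
          (\<forall>u \<in> midpoints (I i - (\<Union>n \<in> N. U n)) (I j). \<phi> u = 0)))"
proof -
  have indices: "(\<exists>i \<in> {1, 2}. \<exists>j \<in> {1, 2}. i \<noteq> j \<and> P i j) \<longleftrightarrow> P 1 2 \<or> P 2 1"
    for P :: "nat \<Rightarrow> nat \<Rightarrow> bool"
    by auto
  show ?thesis
    unfolding functional_equation_iff[OF assms(1,2,4,5,7)] two_sided_def two_sided_with_def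
      one_sided_def indices ex_disj_distrib ..
qed

end
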